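(* For every $n\ge 1$, $$T_n(x)=(1-x^n)\varphi(n)\sum_{d\mid n}\frac{\mu^2(d)\,f_d(n/d)}{\varphi(d)\,(1-x^{n/d})},$$ where $T_n(x)=\sum_{k=0}^{n-1}|c_n(k)|x^k$ and, for positive integers $k,m$, $f_k(m)=\prod_{p\mid m,\ p\nmid k}\big(1-\frac{1}{p-1}\big)$ (product over primes $p$).
   Context: For integers $n\ge 1$ and $k$, the Ramanujan sum $c_n(k)$ is the sum of the $k$th powers of the primitive $n$th roots of unity, i.e. $c_n(k)=\sum_{1\le j\le n,\ \gcd(j,n)=1} e^{2\pi \sqrt{-1}\, jk/n}$. $\varphi$ is Euler's function and $\mu$ the Möbius function. The identity is one of rational functions (equivalently, of polynomials after clearing denominators). *)

theory Defs
  imports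
    Complex_Main
    "HOL-Computational_Algebra.Computational_Algebra"
    "HOL-Number_Theory.Totient"
begin

definition ramanujan_sum :: "nat \<Rightarrow> int \<Rightarrow> complex" where
  "ramanujan_sum n k =
     (\<Sum>j | 1 \<le> j \<and> j \<le> n \<and> gcd j n = 1.
        exp (2 * complex_of_real pi * \<i> * of_nat j * of_int k / of_nat n))"

definition moebius_mu :: "nat \<Rightarrow> int" where
  "moebius_mu n = (if squarefree n then (- 1) ^ card (prime_factors n) else 0)"

definition T_poly :: "nat \<Rightarrow> real poly" where
  "T_poly n = (\<Sum>k<n. monom (cmod (ramanujan_sum n (int k))) k)"

definition f_prod :: "nat \<Rightarrow> nat \<Rightarrow> real" where
  "f_prod k m = (\<Prod>p | prime p \<and> p dvd m \<and> \<not> p dvd k. 1 - 1 / (real p - 1))"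

text \<open>Rational functions over the reals form the fraction field \<^typ>\<open>real poly fract\<close>;
  \<open>ratX\<close> is its indeterminate and \<open>ratC\<close> the embedding of the constants.\<close>

definition ratX :: "real poly fract" where
  "ratX = to_fract [:0, 1:]"

definition ratC :: "real \<Rightarrow> real poly fract" where
  "ratC c = to_fract [:c:]"

end

theory Submission
  imports Defs "HOL-Library.Real_Mod"
begin

text \<open>
  Moebius inversion of the condition \<open>gcd(j, n) = 1\<close> gives the sum of \<open>\<mu>(d) n/d\<close> over the
  divisors \<open>d\<close> of \<open>n\<close> with \<open>n/d | k\<close> as the value of \<open>c\<^sub>n(k)\<close>. With \<open>m = n / gcd(n, k)\<close>, the
  condition \<open>n/d | k\<close> says \<open>m | d\<close>, and sums of multiplicative functions over the squarefree \<open>d\<close> with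
  \<open>m | d | n\<close> are products over the primes dividing \<open>n\<close>. This yields Hoelder's formula
  \<open>c\<^sub>n(k) = \<mu>(m) \<phi>(n) / \<phi>(m)\<close>, and also that \<open>\<mu>\<^sup>2(m) / \<phi>(m)\<close> is the sum of
  \<open>\<mu>\<^sup>2(d) f\<^sub>d(n/d) / \<phi>(d)\<close> over \<open>m | d | n\<close>, because
  \<open>1/(p-1) + (1 - 1/(p-1)) = 1\<close>. Hence \<open>\<bar>c\<^sub>n(k)\<bar> / \<phi>(n)\<close> is the sum of
  \<open>\<mu>\<^sup>2(d) f\<^sub>d(n/d) / \<phi>(d)\<close> over the \<open>d | n\<close> with \<open>n/d | k\<close>, and summing over \<open>k\<close> first leaves
  geometric series with ratio \<open>x\<^bsup>n/d\<^esup>\<close>.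
\<close>

section \<open>Squarefree divisors\<close>

lemma squarefree_gt_0_nat: "squarefree d \<Longrightarrow> d > 0" for d :: nat
  by (cases "d = 0") simp_all

lemma squarefree_prime_factorization:
  fixes d :: "'a :: factorial_semiring"
  assumes "squarefree d"
  shows "prime_factorization d = mset_set (prime_factors d)"
proof (rule multiset_eqI)
  fix p
  have "d \<noteq> 0" using assms by auto
  thus "count (prime_factorization d) p = count (mset_set (prime_factors d)) p"
    using assms
    by (cases "p \<in> prime_factors d")
       (auto simp: squarefree_factorial_semiring' not_in_iff count_prime_factorization)
qed

lemma prod_prime_factors_squarefree:
  fixes d :: nat
  assumes "squarefree d"
  shows "\<Prod>(prime_factors d) = d"
proof -
  have "\<Prod>(prime_factors d) = prod_mset (prime_factorization d)"
    by (subst squarefree_prime_factorization[OF assms]) (simp add: prod_unfold_prod_mset)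
  also have "\<dots> = d"
    using assms by (intro prod_mset_prime_factorization_nat squarefree_gt_0_nat)
  finally show ?thesis .
qed

lemma prime_factorization_prod_primes:
  fixes X :: "'a :: factorial_semiring set"
  assumes "finite X" "\<And>p. p \<in> X \<Longrightarrow> prime p"
  shows "prime_factorization (\<Prod>X) = mset_set X"
  using prime_factorization_prod_mset_primes[of "mset_set X"] assms
  by (simp add: prod_unfold_prod_mset)

lemma squarefree_prod_primes:
  fixes X :: "'a :: factorial_semiring set"
  assumes "finite X" "\<And>p. p \<in> X \<Longrightarrow> prime p"
  shows "squarefree (\<Prod>X)"
proof -
  have "0 \<notin> X" using assms(2)[of 0] by auto
  hence "\<Prod>X \<noteq> 0" using assms(1) by simp
  moreover have "multiplicity p (\<Prod>X) \<le> 1" if "prime p" for p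
    using that prime_factorization_prod_primes[OF assms] assms
    by (auto simp flip: count_prime_factorization_prime simp: count_mset_set')
  ultimately show ?thesis by (simp add: squarefree_factorial_semiring'')
qed

lemma squarefree_dvd_iff_prime_factors_subset:
  fixes m d :: "'a :: factorial_semiring"
  assumes "squarefree m" "d \<noteq> 0"
  shows "m dvd d \<longleftrightarrow> prime_factors m \<subseteq> prime_factors d"
proof
  assume subset: "prime_factors m \<subseteq> prime_factors d"
  have "m \<noteq> 0" using assms by auto
  show "m dvd d"
  proof (rule multiplicity_le_imp_dvd)
    fix p :: 'a assume "prime p"
    have "multiplicity p m \<le> 1"
      using assms \<open>m \<noteq> 0\<close> \<open>prime p\<close> by (simp add: squarefree_factorial_semiring'')
    moreover have "multiplicity p m > 0 \<longrightarrow> multiplicity p d > 0"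
      using subset \<open>prime p\<close> by (auto simp: prime_factors_multiplicity)
    ultimately show "multiplicity p m \<le> multiplicity p d" by linarith
  qed fact
qed (use assms dvd_prime_factors in auto)

lemma bij_betw_prime_factors_squarefree:
  fixes m n :: nat
  assumes "squarefree m" "n > 0"
  shows "bij_betw prime_factors {d. d dvd n \<and> m dvd d \<and> squarefree d}
           {X. prime_factors m \<subseteq> X \<and> X \<subseteq> prime_factors n}"
proof (rule bij_betw_byWitness[where f' = Prod])
  have prod: "prime_factors (\<Prod>X) = X" "squarefree (\<Prod>X)" if "X \<subseteq> prime_factors n" for X
  proof -
    have X: "finite X" "\<And>p. p \<in> X \<Longrightarrow> prime p"
      using that finite_subset[of X "prime_factors n"] by auto
    show "prime_factors (\<Prod>X) = X" by (simp add: prime_factorization_prod_primes X)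
    show "squarefree (\<Prod>X)" by (rule squarefree_prod_primes[OF X])
  qed
  thus "\<forall>X\<in>{X. prime_factors m \<subseteq> X \<and> X \<subseteq> prime_factors n}. prime_factors (\<Prod>X) = X"
    by blast
  show "Prod ` {X. prime_factors m \<subseteq> X \<and> X \<subseteq> prime_factors n} \<subseteq>
          {d. d dvd n \<and> m dvd d \<and> squarefree d}"
  proof clarify
    fix X assume X: "prime_factors m \<subseteq> X" "X \<subseteq> prime_factors n"
    with squarefree_gt_0_nat[OF prod(2)[OF X(2)]]
    show "\<Prod>X dvd n \<and> m dvd \<Prod>X \<and> squarefree (\<Prod>X)"
      using assms prod[OF X(2)] by (simp add: squarefree_dvd_iff_prime_factors_subset)
  qed
  show "prime_factors ` {d. d dvd n \<and> m dvd d \<and> squarefree d} \<subseteq>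
          {X. prime_factors m \<subseteq> X \<and> X \<subseteq> prime_factors n}"
  proof clarify
    fix d assume d: "d dvd n" "m dvd d" "squarefree d"
    with squarefree_gt_0_nat[OF d(3)] assms
    show "prime_factors m \<subseteq> prime_factors d \<and> prime_factors d \<subseteq> prime_factors n"
      by (simp add: dvd_prime_factors)
  qed
qed (auto simp: prod_prime_factors_squarefree)

lemma prod_add_supersets:
  fixes f g :: "'a \<Rightarrow> 'b :: comm_semiring_1"
  assumes "finite A" "B \<subseteq> A"
  shows "(\<Sum>X | B \<subseteq> X \<and> X \<subseteq> A. prod f X * prod g (A - X)) =
         prod f B * (\<Prod>x\<in>A - B. f x + g x)"
proof -
  have "prod f B * (\<Prod>x\<in>A - B. f x + g x) =
        (\<Sum>Y\<in>Pow (A - B). prod f B * (prod f Y * prod g (A - B - Y)))"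
    using assms by (simp add: prod_add sum_distrib_left)
  also have "\<dots> = (\<Sum>X | B \<subseteq> X \<and> X \<subseteq> A. prod f X * prod g (A - X))"
  proof (rule sum.reindex_bij_witness[where i = "\<lambda>X. X - B" and j = "\<lambda>Y. B \<union> Y"])
    fix Y assume "Y \<in> Pow (A - B)"
    hence "finite B" "finite Y" "B \<inter> Y = {}" using assms by (auto intro: finite_subset)
    moreover have "A - (B \<union> Y) = A - B - Y" by blast
    ultimately show "prod f (B \<union> Y) * prod g (A - (B \<union> Y)) =
                     prod f B * (prod f Y * prod g (A - B - Y))"
      by (simp add: prod.union_disjoint mult.assoc)
  qed (use assms in auto)
  finally show ?thesis by simp
qed

lemma sum_squarefree_multiples:
  fixes a b :: "nat \<Rightarrow> 'a :: comm_semiring_1"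
  assumes "n > 0" "m dvd n"
  shows "(\<Sum>d | d dvd n \<and> m dvd d \<and> squarefree d.
            prod a (prime_factors d) * prod b (prime_factors n - prime_factors d)) =
         (if squarefree m then
            prod a (prime_factors m) * (\<Prod>p\<in>prime_factors n - prime_factors m. a p + b p) else 0)"
proof (cases "squarefree m")
  case True
  have "prime_factors m \<subseteq> prime_factors n" using assms by (simp add: dvd_prime_factors)
  thus ?thesis
    using sum.reindex_bij_betw[OF bij_betw_prime_factors_squarefree[OF True assms(1)],
        of "\<lambda>X. prod a X * prod b (prime_factors n - X)"] True
    by (simp add: prod_add_supersets)
next
  case False
  hence "{d. d dvd n \<and> m dvd d \<and> squarefree d} = {}" using squarefree_mono by blast
  thus ?thesis using False by (simp only: sum.empty if_False)
qed

section \<open>The Moebius function and the totient\<close>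

lemma moebius_mu_squarefree: "squarefree d \<Longrightarrow> moebius_mu d = (\<Prod>p\<in>prime_factors d. - 1)"
  by (simp add: moebius_mu_def)

lemma moebius_mu_not_squarefree: "\<not> squarefree d \<Longrightarrow> moebius_mu d = 0"
  by (simp add: moebius_mu_def)

lemma moebius_mu_power2: "(moebius_mu d)\<^sup>2 = (if squarefree d then 1 else 0)"
  by (simp add: moebius_mu_def flip: power_mult)

lemma abs_moebius_mu: "\<bar>moebius_mu d\<bar> = (moebius_mu d)\<^sup>2"
  by (simp add: moebius_mu_power2) (simp add: moebius_mu_def power_abs)

lemma sum_moebius_mu_multiples:
  fixes g :: "nat \<Rightarrow> 'a :: comm_ring_1"
  assumes "n > 0" "m dvd n"
  shows "(\<Sum>d | d dvd n \<and> m dvd d. of_int (moebius_mu d) * prod g (prime_factors d)) =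
         of_int (moebius_mu m) * prod g (prime_factors m) *
           (\<Prod>p\<in>prime_factors n - prime_factors m. 1 - g p)"
proof -
  have mu_prod: "of_int (moebius_mu d) * prod g (prime_factors d) = (\<Prod>p\<in>prime_factors d. - g p)"
    if "squarefree d" for d
    using that by (simp add: moebius_mu_squarefree prod_uminus)
  have "(\<Sum>d | d dvd n \<and> m dvd d. of_int (moebius_mu d) * prod g (prime_factors d)) =
        (\<Sum>d | d dvd n \<and> m dvd d \<and> squarefree d.
           (\<Prod>p\<in>prime_factors d. - g p) * (\<Prod>p\<in>prime_factors n - prime_factors d. 1))"
    using assms(1)
    by (intro sum.mono_neutral_cong_right) (auto simp: mu_prod moebius_mu_not_squarefree)
  also have "\<dots> = (if squarefree m then (\<Prod>p\<in>prime_factors m. - g p) *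
                      (\<Prod>p\<in>prime_factors n - prime_factors m. - g p + 1) else 0)"
    by (rule sum_squarefree_multiples[OF assms])
  also have "\<dots> = of_int (moebius_mu m) * prod g (prime_factors m) *
                      (\<Prod>p\<in>prime_factors n - prime_factors m. 1 - g p)"
    by (simp add: mu_prod moebius_mu_not_squarefree)
  finally show ?thesis .
qed

corollary sum_moebius_mu_divisors:
  assumes "n > 0"
  shows "(\<Sum>d | d dvd n. moebius_mu d) = (if n = 1 then 1 else 0)"
proof -
  have "(\<Sum>d | d dvd n. moebius_mu d) = (\<Prod>p\<in>prime_factors n. 0)"
    using sum_moebius_mu_multiples[OF assms one_dvd, where g = "\<lambda>_. 1 :: int"]
    by (simp add: moebius_mu_def)
  also have "\<dots> = (if n = 1 then 1 else 0)"
    using assms by (auto simp: card_gt_0_iff prime_factorization_empty_iff)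
  finally show ?thesis .
qed

corollary sum_moebius_mu_divide_multiples:
  assumes "n > 0" "m dvd n"
  shows "(\<Sum>d | d dvd n \<and> m dvd d. real_of_int (moebius_mu d) / d) =
         moebius_mu m * (totient n / n) / totient m"
proof -
  let ?g = "\<lambda>p. 1 / real p"
  have mu_div: "real_of_int (moebius_mu d) / d = moebius_mu d * prod ?g (prime_factors d)" for d
  proof (cases "squarefree d")
    case True
    hence "real d = (\<Prod>p\<in>prime_factors d. real p)"
      by (simp add: prod_prime_factors_squarefree flip: of_nat_prod)
    thus ?thesis by (simp add: prod_dividef)
  qed (simp add: moebius_mu_not_squarefree)
  have "m > 0" using assms by (auto intro: Nat.gr0I)
  have "prime_factors m \<subseteq> prime_factors n" using assms by (simp add: dvd_prime_factors)
  hence "totient n / n = (\<Prod>p\<in>prime_factors n - prime_factors m. 1 - ?g p) * (totient m / m)"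
    using assms \<open>m > 0\<close> by (simp add: totient_formula2 flip: prod.subset_diff)
  hence "(\<Prod>p\<in>prime_factors n - prime_factors m. 1 - ?g p) = (totient n / n) / totient m * m"
    using \<open>m > 0\<close> by simp
  thus ?thesis
    using sum_moebius_mu_multiples[OF assms, of ?g] \<open>m > 0\<close> by (simp flip: mu_div)
qed

lemma totient_squarefree:
  assumes "squarefree d"
  shows "real (totient d) = (\<Prod>p\<in>prime_factors d. real p - 1)"
proof -
  have "real (totient d) = (\<Prod>p\<in>prime_factors d. real p) * (\<Prod>p\<in>prime_factors d. 1 - 1 / real p)"
    using assms by (simp add: totient_formula2 prod_prime_factors_squarefree flip: of_nat_prod)
  also have "\<dots> = (\<Prod>p\<in>prime_factors d. real p - 1)"
    unfolding prod.distrib[symmetric]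
    by (intro prod.cong) (auto simp: field_simps dest!: in_prime_factors_imp_prime prime_gt_0_nat)
  finally show ?thesis .
qed

lemma f_prod_div:
  assumes "n > 0" "d dvd n"
  shows "f_prod d (n div d) = (\<Prod>p\<in>prime_factors n - prime_factors d. 1 - 1 / (real p - 1))"
proof -
  from assms(2) obtain e where n: "n = d * e" ..
  with assms(1) have "d > 0" "e > 0" by (auto intro: Nat.gr0I)
  with n have "{p. prime p \<and> p dvd n div d \<and> \<not> p dvd d} = prime_factors n - prime_factors d"
    by (auto simp: prime_factors_dvd prime_dvd_mult_iff)
  thus ?thesis by (simp add: f_prod_def)
qed

lemma sum_f_prod_multiples:
  assumes "n > 0" "m dvd n"
  shows "(\<Sum>d | d dvd n \<and> m dvd d. (moebius_mu d)\<^sup>2 * f_prod d (n div d) / totient d) =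
         (moebius_mu m)\<^sup>2 / totient m"
proof -
  define a where "a = (\<lambda>p. 1 / (real p - 1))"
  have totient: "1 / totient d = prod a (prime_factors d)" if "squarefree d" for d
    using that by (simp add: a_def totient_squarefree prod_dividef)
  have f_prod: "f_prod d (n div d) = (\<Prod>p\<in>prime_factors n - prime_factors d. 1 - a p)"
    if "d dvd n" for d
    using that assms(1) by (simp add: f_prod_div a_def)
  have "(\<Sum>d | d dvd n \<and> m dvd d. (moebius_mu d)\<^sup>2 * f_prod d (n div d) / totient d) =
        (\<Sum>d | d dvd n \<and> m dvd d \<and> squarefree d.
           prod a (prime_factors d) * (\<Prod>p\<in>prime_factors n - prime_factors d. 1 - a p))"
    using assms(1)
    by (intro sum.mono_neutral_cong_right)
       (auto simp: moebius_mu_power2 f_prod simp flip: totient)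
  also have "\<dots> = (if squarefree m then prod a (prime_factors m) *
                      (\<Prod>p\<in>prime_factors n - prime_factors m. a p + (1 - a p)) else 0)"
    by (rule sum_squarefree_multiples[OF assms])
  also have "\<dots> = (moebius_mu m)\<^sup>2 / totient m"
    by (simp add: moebius_mu_power2 totient)
  finally show ?thesis .
qed

section \<open>Ramanujan sums\<close>

definition unity_root :: "nat \<Rightarrow> int \<Rightarrow> complex" where
  "unity_root n a = cis (2 * pi * a / n)"

lemma unity_root_mult: "unity_root n (int j * a) = unity_root n a ^ j"
  by (simp add: unity_root_def DeMoivre mult_ac)

lemma unity_root_cancel: "d > 0 \<Longrightarrow> unity_root (d * n) (int d * a) = unity_root n a"
  by (simp add: unity_root_def mult.assoc)

lemma unity_root_eq_1_iff:
  assumes "n > 0"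
  shows "unity_root n a = 1 \<longleftrightarrow> int n dvd a"
proof -
  have "unity_root n a = 1 \<longleftrightarrow> (\<exists>k. real_of_int a = of_int (int n * k))"
    using assms by (simp add: unity_root_def cis_eq_1_iff field_simps)
  thus ?thesis by (simp only: of_int_eq_iff dvd_def)
qed

lemma sum_unity_root:
  assumes "n > 0"
  shows "(\<Sum>j\<in>{0<..n}. unity_root n (int j * a)) = (if int n dvd a then of_nat n else 0)"
proof -
  let ?z = "unity_root n a"
  have "?z ^ n = 1" using assms by (simp add: unity_root_eq_1_iff flip: unity_root_mult)
  have "(\<Sum>j\<in>{0<..n}. ?z ^ j) = (\<Sum>j<n. ?z ^ Suc j)"
    by (rule sum.reindex_bij_witness[where i = Suc and j = "\<lambda>j. j - 1"]) auto
  also have "\<dots> = (if ?z = 1 then of_nat n else 0)"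
    using \<open>?z ^ n = 1\<close> by (simp add: geometric_sum flip: sum_distrib_left)
  finally show ?thesis using assms by (simp add: unity_root_mult unity_root_eq_1_iff)
qed

lemma sum_totatives_moebius:
  fixes F :: "nat \<Rightarrow> 'a :: comm_ring_1"
  assumes "n > 0"
  shows "sum F (totatives n) =
         (\<Sum>d | d dvd n. of_int (moebius_mu d) * (\<Sum>j\<in>{0<..n div d}. F (j * d)))"
proof -
  have coprime_indicator:
    "(\<Sum>d | d dvd gcd j n. of_int (moebius_mu d) * F j) = (if coprime j n then F j else 0)" for j
  proof -
    have "(\<Sum>d | d dvd gcd j n. of_int (moebius_mu d) * F j) =
          of_int (\<Sum>d | d dvd gcd j n. moebius_mu d) * F j"
      by (simp only: of_int_sum sum_distrib_right)
    also have "\<dots> = (if coprime j n then F j else 0)"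
      using assms by (subst sum_moebius_mu_divisors) (auto simp: coprime_iff_gcd_eq_1)
    finally show ?thesis .
  qed
  have "sum F (totatives n) = (\<Sum>j\<in>{0<..n}. \<Sum>d | d dvd gcd j n. of_int (moebius_mu d) * F j)"
    unfolding coprime_indicator totatives_def by (rule sum.inter_filter) simp
  also have "\<dots> = (\<Sum>j\<in>{0<..n}. \<Sum>d | d \<in> {d. d dvd n} \<and> d dvd j. of_int (moebius_mu d) * F j)"
    by (simp add: conj_commute)
  also have "\<dots> = (\<Sum>d | d dvd n. \<Sum>j | j \<in> {0<..n} \<and> d dvd j. of_int (moebius_mu d) * F j)"
    using assms by (intro sum.swap_restrict) auto
  also have "\<dots> = (\<Sum>d | d dvd n. of_int (moebius_mu d) * (\<Sum>j\<in>{0<..n div d}. F (j * d)))"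
    unfolding sum_distrib_left
  proof (rule sum.cong[OF refl])
    fix d assume "d \<in> {d. d dvd n}"
    hence d: "d dvd n" "d > 0" using assms by (auto intro: Nat.gr0I)
    show "(\<Sum>j | j \<in> {0<..n} \<and> d dvd j. of_int (moebius_mu d) * F j) =
          (\<Sum>j\<in>{0<..n div d}. of_int (moebius_mu d) * F (j * d))"
      by (rule sum.reindex_bij_witness[where i = "\<lambda>j. j * d" and j = "\<lambda>j. j div d"])
         (use d in \<open>auto simp: less_eq_div_iff_mult_less_eq div_le_mono\<close>)
  qed
  finally show ?thesis .
qed

lemma ramanujan_sum_conv_unity_root:
  "ramanujan_sum n k = (\<Sum>j\<in>totatives n. unity_root n (int j * k))"
  unfolding ramanujan_sum_def
  by (intro sum.cong)
     (auto simp: totatives_def unity_root_def cis_conv_exp coprime_iff_gcd_eq_1 mult_ac)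

lemma ramanujan_sum_conv_moebius:
  assumes "n > 0"
  shows "ramanujan_sum n k =
         of_real (n * (\<Sum>d | d dvd n \<and> int (n div d) dvd k. real_of_int (moebius_mu d) / d))"
proof -
  have "ramanujan_sum n k = (\<Sum>d | d dvd n. of_int (moebius_mu d) *
          (\<Sum>j\<in>{0<..n div d}. unity_root n (int (j * d) * k)))"
    unfolding ramanujan_sum_conv_unity_root by (rule sum_totatives_moebius[OF assms])
  also have "\<dots> = (\<Sum>d | d dvd n. of_int (moebius_mu d) *
                    (if int (n div d) dvd k then of_nat (n div d) else 0))"
  proof (intro sum.cong refl arg_cong2[where f = "(*)"])
    fix d assume "d \<in> {d. d dvd n}"
    then obtain e where n: "n = d * e" by auto
    with assms have "d > 0" "e > 0" by (auto intro: Nat.gr0I)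
    thus "(\<Sum>j\<in>{0<..n div d}. unity_root n (int (j * d) * k)) =
          (if int (n div d) dvd k then of_nat (n div d) else 0)"
      using sum_unity_root[of e k] unity_root_cancel[of d e]
      by (simp add: n mult.assoc mult.left_commute[of _ "int d"])
  qed
  also have "\<dots> = (\<Sum>d | d dvd n \<and> int (n div d) dvd k. of_int (moebius_mu d) * of_nat (n div d))"
    using assms by (intro sum.mono_neutral_cong_right) auto
  also have "\<dots> = of_real (n * (\<Sum>d | d dvd n \<and> int (n div d) dvd k. real_of_int (moebius_mu d) / d))"
    using assms by (auto simp: sum_distrib_left real_of_nat_div intro!: sum.cong)
  finally show ?thesis .
qed

lemma div_gcd_dvd: "n div gcd n k dvd n" for n k :: "'a :: semiring_gcd"
  by (cases "n = 0") (simp_all add: div_dvd_iff_mult)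

lemma div_dvd_iff_div_gcd_dvd:
  fixes n d k :: "'a :: semiring_gcd"
  assumes "n \<noteq> 0" "d dvd n"
  shows "n div d dvd k \<longleftrightarrow> n div gcd n k dvd d"
proof -
  have "d \<noteq> 0" using assms by auto
  hence "n div d dvd k \<longleftrightarrow> n dvd d * k" using assms by (simp add: div_dvd_iff_mult mult.commute)
  also have "\<dots> \<longleftrightarrow> n dvd gcd (d * n) (d * k)" by simp
  also have "\<dots> \<longleftrightarrow> n dvd d * gcd n k" by (simp add: gcd_mult_left)
  also have "\<dots> \<longleftrightarrow> n div gcd n k dvd d" using assms by (simp add: div_dvd_iff_mult)
  finally show ?thesis .
qed

corollary int_div_dvd_iff_div_gcd_dvd:
  assumes "n > 0" "d dvd n"
  shows "int (n div d) dvd k \<longleftrightarrow> n div nat (gcd (int n) k) dvd d"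
  using div_dvd_iff_div_gcd_dvd[of n d "nat \<bar>k\<bar>"] assms by (simp add: dvd_nat_abs_iff)

theorem ramanujan_sum_hoelder:
  assumes "n > 0" and m_def: "m = n div nat (gcd (int n) k)"
  shows "ramanujan_sum n k = of_real (moebius_mu m * totient n / totient m)"
proof -
  have "m dvd n" using div_gcd_dvd[of n "nat \<bar>k\<bar>"] by (simp add: m_def)
  have "{d. d dvd n \<and> int (n div d) dvd k} = {d. d dvd n \<and> m dvd d}"
    using assms by (auto simp: int_div_dvd_iff_div_gcd_dvd)
  thus ?thesis
    using assms(1) sum_moebius_mu_divide_multiples[OF assms(1) \<open>m dvd n\<close>]
    by (simp add: ramanujan_sum_conv_moebius)
qed

corollary norm_ramanujan_sum:
  assumes "n > 0"
  shows "cmod (ramanujan_sum n k) =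
         (\<Sum>d | d dvd n \<and> int (n div d) dvd k.
            totient n * ((moebius_mu d)\<^sup>2 * f_prod d (n div d) / totient d))"
proof -
  define m where "m = n div nat (gcd (int n) k)"
  have "m dvd n" using div_gcd_dvd[of n "nat \<bar>k\<bar>"] by (simp add: m_def)
  have "cmod (ramanujan_sum n k) = totient n * ((moebius_mu m)\<^sup>2 / totient m)"
    by (simp add: ramanujan_sum_hoelder[OF assms m_def] norm_mult norm_divide
          flip: abs_moebius_mu of_int_abs)
  also have "\<dots> = (\<Sum>d | d dvd n \<and> m dvd d.
      totient n * ((moebius_mu d)\<^sup>2 * f_prod d (n div d) / totient d))"
    unfolding sum_distrib_left[symmetric] sum_f_prod_multiples[OF assms \<open>m dvd n\<close>] ..
  also have "{d. d dvd n \<and> m dvd d} = {d. d dvd n \<and> int (n div d) dvd k}"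
    using assms by (auto simp: int_div_dvd_iff_div_gcd_dvd m_def)
  finally show ?thesis .
qed

section \<open>Generating functions\<close>

lemma sum_power_multiples:
  fixes x :: "'a :: field"
  assumes "e dvd n" "x ^ e \<noteq> 1"
  shows "(\<Sum>k | k < n \<and> e dvd k. x ^ k) = (1 - x ^ n) / (1 - x ^ e)"
proof -
  from assms(1) obtain d where n: "n = e * d" ..
  have "e > 0" using assms(2) by (auto intro: Nat.gr0I)
  have "(\<Sum>k | k < n \<and> e dvd k. x ^ k) = (\<Sum>i<d. (x ^ e) ^ i)"
    by (rule sum.reindex_bij_witness[where i = "\<lambda>i. e * i" and j = "\<lambda>k. k div e"])
       (use \<open>e > 0\<close> n in \<open>auto simp flip: power_mult\<close>)
  also have "\<dots> = (1 - x ^ n) / (1 - x ^ e)"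
    using assms(2) by (simp add: sum_gp_strict n power_mult)
  finally show ?thesis .
qed

lemma to_fract_power: "to_fract (x ^ k) = to_fract x ^ k"
  by (induction k) auto

lemma to_fract_monom: "to_fract (monom c k) = ratC c * ratX ^ k"
  by (simp add: ratC_def ratX_def monom_altdef flip: to_fract_power to_fract_mult)

lemma ratC_mult: "ratC (a * b) = ratC a * ratC b"
  by (simp add: ratC_def flip: to_fract_mult)

lemma ratC_divide: "b \<noteq> 0 \<Longrightarrow> ratC (a / b) = ratC a / ratC b"
  using ratC_mult[of "a / b" b] by (simp add: ratC_def eq_divide_eq)

lemma ratC_sum: "ratC (sum f A) = (\<Sum>x\<in>A. ratC (f x))"
  using sum_comp_morphism[of ratC f A] by (simp add: ratC_def comp_def flip: to_fract_add)

lemma ratX_power_neq_1: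
  assumes "k > 0"
  shows "ratX ^ k \<noteq> 1"
proof
  assume "ratX ^ k = 1"
  hence "[:0, 1 :: real:] ^ k = 1"
    by (simp add: ratX_def flip: to_fract_power to_fract_1)
  hence "degree ([:0, 1 :: real:] ^ k) = 0" by simp
  thus False using assms by (simp add: degree_power_eq)
qed

lemma sum_ratX_power_multiples:
  assumes "n > 0" "d dvd n"
  shows "(\<Sum>k | k < n \<and> n div d dvd k. ratC c * ratX ^ k) =
         ratC c * ((1 - ratX ^ n) / (1 - ratX ^ (n div d)))"
proof -
  have "n div d > 0" "n div d dvd n" using assms by (auto simp: dvd_div_eq_0_iff intro: Nat.gr0I)
  thus ?thesis
    by (simp add: sum_power_multiples ratX_power_neq_1 flip: sum_distrib_left)
qed

lemma to_fract_T_poly: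
  "to_fract (T_poly n) = (\<Sum>k<n. ratC (cmod (ramanujan_sum n (int k))) * ratX ^ k)"
  by (simp add: T_poly_def to_fract_monom)

theorem theorem11:
  fixes n :: nat
  assumes "n \<ge> 1"
  shows "to_fract (T_poly n) =
    (1 - ratX ^ n) * ratC (real (totient n)) *
    (\<Sum>d | d dvd n.
       ratC (real_of_int ((moebius_mu d)\<^sup>2) * f_prod d (n div d)) /
       (ratC (real (totient d)) * (1 - ratX ^ (n div d))))"
proof -
  have "n > 0" using assms by simp
  define c where "c = (\<lambda>d. (moebius_mu d)\<^sup>2 * f_prod d (n div d))"
  have "to_fract (T_poly n) = (\<Sum>k<n. \<Sum>d | d \<in> {d. d dvd n} \<and> n div d dvd k.
          ratC (totient n * (c d / totient d)) * ratX ^ k)"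
    using \<open>n > 0\<close>
    by (simp add: to_fract_T_poly norm_ramanujan_sum c_def ratC_sum sum_distrib_right)
  also have "\<dots> = (\<Sum>d | d dvd n. \<Sum>k | k \<in> {..<n} \<and> n div d dvd k.
          ratC (totient n * (c d / totient d)) * ratX ^ k)"
    using \<open>n > 0\<close> by (intro sum.swap_restrict) auto
  also have "\<dots> = (\<Sum>d | d dvd n. ratC (totient n * (c d / totient d)) *
          ((1 - ratX ^ n) / (1 - ratX ^ (n div d))))"
    using \<open>n > 0\<close> by (simp add: sum_ratX_power_multiples)
  also have "\<dots> = (\<Sum>d | d dvd n. (1 - ratX ^ n) * ratC (totient n) *
          (ratC (c d) / (ratC (totient d) * (1 - ratX ^ (n div d)))))"
    using \<open>n > 0\<close> by (intro sum.cong) (auto simp: ratC_mult ratC_divide)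
  finally show ?thesis by (simp add: c_def sum_distrib_left)
qed

end
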